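(* Let $M$ be an $n\times n$ $q$-Manin matrix over $\mathfrak R$, partitioned into blocks $$M=\begin{pmatrix}A&B\\C&D\end{pmatrix},$$ where $A$, $B$, $C$, $D$ have sizes $m\times m$, $m\times(n-m)$, $(n-m)\times m$, $(n-m)\times(n-m)$ respectively. Suppose that $M$, $A$ and $D$ are right-invertible and that their $q$-determinants $\det_q M$, $\det_q A$ and $\det_q D$ are left-invertible (hence all of these are two-sided invertible). Then the Schur complements $A-BD^{-1}C$ and $D-CA^{-1}B$ are $q$-Manin matrices, and $$\det\nolimits_q M=\det\nolimits_q D\;\det\nolimits_q(A-BD^{-1}C),\qquad \det\nolimits_q M=\det\nolimits_q A\;\det\nolimits_q(D-CA^{-1}B).$$
   Context: Let $q$ be a nonzero complex number and $\mathfrak R$ an associative unital, not necessarily commutative, algebra over $\mathbb C$. An $n\times m$ matrix $M=(M_{ij})$ over $\mathfrak R$ is called $q$-Manin if $M_{ij}M_{kj}=q^{-1}M_{kj}M_{ij}$ for all $j$ and all $i<k$, and $M_{ij}M_{kl}-M_{kl}M_{ij}=q^{-1}M_{kj}M_{il}-q\,M_{il}M_{kj}$ for all $i<k$, $j<l$. The $q$-determinant of an $n\times n$ matrix is $\det_q M=\sum_{\tau\in\mathfrak S_n}(-q)^{-\mathrm{inv}(\tau)}M_{\tau(1)1}M_{\tau(2)2}\cdots M_{\tau(n)n}$, where $\mathrm{inv}(\tau)$ is the number of inversions of $\tau$. *)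

theory Defs
  imports
    Complex_Main
    "HOL-Combinatorics.Permutations"
    "Jordan_Normal_Form.Matrix"
begin

text \<open>
  Associative unital algebras over the complex numbers.  The sort \<open>{ring, monoid_mult}\<close> is
  \<open>ring_1\<close> without the axiom \<open>0 \<noteq> 1\<close>, so the zero algebra is allowed.
\<close>

locale complex_algebra = vector_space scale
  for scale :: "complex \<Rightarrow> 'a :: {ring, monoid_mult} \<Rightarrow> 'a" +
  assumes scale_mult_left: "scale c x * y = scale c (x * y)"
    and scale_mult_right: "x * scale c y = scale c (x * y)"

text \<open>Matrix and permutation indices start at 0.\<close>

definition q_manin ::
  "(complex \<Rightarrow> 'a \<Rightarrow> 'a) \<Rightarrow> complex \<Rightarrow> 'a :: {ring, monoid_mult} mat \<Rightarrow> bool" where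
  "q_manin scale q M \<longleftrightarrow>
     (\<forall>j < dim_col M. \<forall>k < dim_row M. \<forall>i < k.
        M $$ (i, j) * M $$ (k, j) = scale (inverse q) (M $$ (k, j) * M $$ (i, j))) \<and>
     (\<forall>k < dim_row M. \<forall>i < k. \<forall>l < dim_col M. \<forall>j < l.
        M $$ (i, j) * M $$ (k, l) - M $$ (k, l) * M $$ (i, j) =
        scale (inverse q) (M $$ (k, j) * M $$ (i, l)) - scale q (M $$ (i, l) * M $$ (k, j)))"

definition perm_inversions :: "nat \<Rightarrow> (nat \<Rightarrow> nat) \<Rightarrow> nat" where
  "perm_inversions n \<tau> = card {(i, j). i < j \<and> j < n \<and> \<tau> j < \<tau> i}"

text \<open>
  The factors are noncommuting and are multiplied in the order of the columns.
  The value is meant for square matrices only.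
\<close>

definition q_det ::
  "(complex \<Rightarrow> 'a \<Rightarrow> 'a) \<Rightarrow> complex \<Rightarrow> 'a :: {ring, monoid_mult} mat \<Rightarrow> 'a" where
  "q_det scale q M =
     (\<Sum>\<tau> | \<tau> permutes {0..<dim_col M}.
        scale ((- q) powi (- int (perm_inversions (dim_col M) \<tau>)))
          (prod_list (map (\<lambda>j. M $$ (\<tau> j, j)) [0..<dim_col M])))"

definition left_invertible :: "'a :: monoid_mult \<Rightarrow> bool" where
  "left_invertible x \<longleftrightarrow> (\<exists>y. y * x = 1)"

definition two_sided_invertible :: "'a :: monoid_mult \<Rightarrow> bool" where
  "two_sided_invertible x \<longleftrightarrow> (\<exists>y. y * x = 1 \<and> x * y = 1)"

text \<open>
  The library notions \<open>inverts_mat\<close> and \<open>invertible_mat\<close> require \<open>semiring_1\<close>, hence \<open>0 \<noteq> 1\<close>,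
  and do not fix the size of a one-sided inverse.
\<close>

definition right_invertible_mat :: "'a :: {ring, monoid_mult} mat \<Rightarrow> bool" where
  "right_invertible_mat A \<longleftrightarrow>
     (\<exists>B \<in> carrier_mat (dim_col A) (dim_row A). A * B = 1\<^sub>m (dim_row A))"

definition is_inverse_mat :: "'a :: {ring, monoid_mult} mat \<Rightarrow> 'a mat \<Rightarrow> bool" where
  "is_inverse_mat A B \<longleftrightarrow>
     B \<in> carrier_mat (dim_col A) (dim_row A) \<and>
     A * B = 1\<^sub>m (dim_row A) \<and> B * A = 1\<^sub>m (dim_col A)"

definition two_sided_invertible_mat :: "'a :: {ring, monoid_mult} mat \<Rightarrow> bool" where
  "two_sided_invertible_mat A \<longleftrightarrow> (\<exists>B. is_inverse_mat A B)"

text \<open>Unspecified unless \<open>A\<close> is two-sided invertible.\<close>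

definition inverse_mat :: "'a :: {ring, monoid_mult} mat \<Rightarrow> 'a mat" where
  "inverse_mat A = (THE B. is_inverse_mat A B)"

end

theory Submission
  imports Defs "HOL-Combinatorics.Multiset_Permutations"
begin

text \<open>
  The proof takes place in the quantum exterior algebra with coefficients in the algebra \<open>R\<close>. Its
  generators \<open>\<psi>\<^sub>i\<close> commute with \<open>R\<close> and satisfy \<open>\<psi>\<^sub>i \<psi>\<^sub>i = 0\<close> and \<open>\<psi>\<^sub>k \<psi>\<^sub>i = p \<psi>\<^sub>i \<psi>\<^sub>k\<close> for \<open>i < k\<close>, where
  \<open>p = -1/q\<close>. To a matrix \<open>M\<close> belong the degree-one elements \<open>\<phi>\<^sub>j = \<Sum>\<^sub>i \<psi>\<^sub>i M\<^sub>i\<^sub>j\<close> given by its columns.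
  Comparing coefficients of \<open>\<psi>\<^sub>i \<psi>\<^sub>k\<close> shows that \<open>M\<close> is \<open>q\<close>-Manin precisely when the \<open>\<phi>\<^sub>j\<close> satisfy the
  same relations as the \<open>\<psi>\<^sub>i\<close> (\<open>q_manin_iff_q_anticommuting\<close>), and \<open>det\<^sub>q M\<close> is the coefficient of the
  product of all \<open>\<psi>\<^sub>i\<close> in the product of all \<open>\<phi>\<^sub>j\<close> (\<open>word_top_eq_q_det\<close>).

  Both statements about Schur complements come from one computation. Let \<open>P\<close> be the set of indices of
  the invertible diagonal block \<open>D\<close> and \<open>Q\<close> its complement. Subtracting from each \<open>\<phi>\<^sub>j\<close> with \<open>j \<in> Q\<close> a
  right linear combination of the \<open>\<phi>\<^sub>l\<close> with \<open>l \<in> P\<close> yields elements \<open>\<phi>'\<^sub>j\<close> that only involve \<open>\<psi>\<^sub>i\<close> with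
  \<open>i \<in> Q\<close>; they are the columns of the Schur complement \<open>S\<close>. A product that starts with the product \<open>\<phi>\<^sub>P\<close> of all
  \<open>\<phi>\<^sub>l\<close> with \<open>l \<in> P\<close> vanishes as soon as some such \<open>\<phi>\<^sub>l\<close> occurs again, so \<open>\<phi>\<^sub>P \<phi>'\<^sub>a \<phi>'\<^sub>b \<dots> = \<phi>\<^sub>P \<phi>\<^sub>a \<phi>\<^sub>b \<dots>\<close> (\<open>word_column_operations\<close>). On the left
  only the part \<open>\<psi>\<^sub>P det\<^sub>q D\<close> of \<open>\<phi>\<^sub>P\<close> contributes to coefficients of monomials divisible by \<open>\<psi>\<^sub>P\<close>. Taking
  all of \<open>Q\<close> in order gives \<open>det\<^sub>q M = det\<^sub>q D det\<^sub>q S\<close>, because reordering the \<open>\<phi>\<^sub>j\<close> and reordering the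
  \<open>\<psi>\<^sub>i\<close> cost the same power of \<open>p\<close>. Taking two indices shows that the relations among
  the \<open>\<phi>\<^sub>j\<close> hold for the \<open>\<phi>'\<^sub>j\<close> after multiplication by \<open>det\<^sub>q D\<close> from the left, and \<open>det\<^sub>q D\<close> can be
  cancelled; hence \<open>S\<close> is \<open>q\<close>-Manin (\<open>schur_complement\<close>).

  Two-sided invertibility of a \<open>q\<close>-Manin matrix \<open>M\<close> and of its determinant follows from two dual
  arguments. The coefficients of the products of all but one \<open>\<phi>\<^sub>j\<close> form, up to scalars, a left adjugate of \<open>M\<close>, so a
  left inverse of \<open>det\<^sub>q M\<close> gives a left inverse of \<open>M\<close> (\<open>left_invertible_q_det_imp_left_inverse\<close>). If
  \<open>M N = 1\<close>, then every \<open>\<psi>\<^sub>k\<close> is a right combination of the \<open>\<phi>\<^sub>j\<close>; hence the product of all \<open>\<psi>\<^sub>k\<close> is a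
  right multiple of the product of all \<open>\<phi>\<^sub>j\<close>, that is, \<open>1 = det\<^sub>q M r\<close> for some \<open>r\<close>
  (\<open>right_inverse_imp_right_invertible_q_det\<close>).
\<close>

section \<open>Matrices over a unital ring that may be trivial\<close>

lemma index_mult_mat_sum:
  fixes A B :: "'a :: semiring_0 mat"
  assumes "A \<in> carrier_mat nr n" "B \<in> carrier_mat n nc" "i < nr" "j < nc"
  shows "(A * B) $$ (i, j) = (\<Sum>r<n. A $$ (i, r) * B $$ (r, j))"
  using assms by (simp add: scalar_prod_def lessThan_atLeast0)

lemma one_mat_mult_left:
  fixes A :: "'a :: {ring, monoid_mult} mat"
  assumes "A \<in> carrier_mat nr nc"
  shows "1\<^sub>m nr * A = A"
proof (rule eq_matI)
  fix i j assume ij: "i < dim_row A" "j < dim_col A"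
  have "(1\<^sub>m nr * A) $$ (i, j) = (\<Sum>r<nr. 1\<^sub>m nr $$ (i, r) * A $$ (r, j))"
    using assms ij by (intro index_mult_mat_sum[of _ nr nr _ nc]) auto
  also have "\<dots> = (\<Sum>r\<in>{i}. 1\<^sub>m nr $$ (i, r) * A $$ (r, j))"
    using assms ij by (intro sum.mono_neutral_right) auto
  finally show "(1\<^sub>m nr * A) $$ (i, j) = A $$ (i, j)" using assms ij by simp
qed (use assms in auto)

lemma one_mat_mult_right:
  fixes A :: "'a :: {ring, monoid_mult} mat"
  assumes "A \<in> carrier_mat nr nc"
  shows "A * 1\<^sub>m nc = A"
proof (rule eq_matI)
  fix i j assume ij: "i < dim_row A" "j < dim_col A"
  have "(A * 1\<^sub>m nc) $$ (i, j) = (\<Sum>r<nc. A $$ (i, r) * 1\<^sub>m nc $$ (r, j))"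
    using assms ij by (intro index_mult_mat_sum[of _ nr nc _ nc]) auto
  also have "\<dots> = (\<Sum>r\<in>{j}. A $$ (i, r) * 1\<^sub>m nc $$ (r, j))"
    using assms ij by (intro sum.mono_neutral_right) auto
  finally show "(A * 1\<^sub>m nc) $$ (i, j) = A $$ (i, j)" using assms ij by simp
qed (use assms in auto)

lemma left_inverse_eq_right_inverse_mat:
  fixes A :: "'a :: {ring, monoid_mult} mat"
  assumes "A \<in> carrier_mat n n" "L \<in> carrier_mat n n" "R \<in> carrier_mat n n"
    and "L * A = 1\<^sub>m n" "A * R = 1\<^sub>m n"
  shows "L = R"
proof -
  have "L = L * (A * R)" using assms by (simp add: one_mat_mult_right)
  also have "\<dots> = (L * A) * R" by (rule assoc_mult_mat[OF assms(2,1,3), symmetric])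
  also have "\<dots> = R" using assms by (simp add: one_mat_mult_left)
  finally show ?thesis .
qed

lemma is_inverse_inverse_mat:
  assumes "A \<in> carrier_mat n n" "two_sided_invertible_mat A"
  shows "is_inverse_mat A (inverse_mat A)"
  unfolding inverse_mat_def
proof (rule theI')
  obtain B where B: "is_inverse_mat A B"
    using assms(2) by (auto simp: two_sided_invertible_mat_def)
  show "\<exists>!B. is_inverse_mat A B"
  proof (rule ex1I[of _ B], fact B)
    show "C = B" if "is_inverse_mat A C" for C
      using that B assms(1) left_inverse_eq_right_inverse_mat[of A n C B]
      by (auto simp: is_inverse_mat_def)
  qed
qed

section \<open>Inversions of lists\<close>

text \<open>
  The number of transpositions needed to sort the concatenation of the increasing words on disjoint
  sets \<open>J\<close> and \<open>K\<close>. It governs the sign in the product of two monomials.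
\<close>

definition crossings :: "nat set \<Rightarrow> nat set \<Rightarrow> nat" where
  "crossings J K = card {(j, k). j \<in> J \<and> k \<in> K \<and> k < j}"

lemma crossings_empty [simp]: "crossings {} K = 0" "crossings J {} = 0"
  by (simp_all add: crossings_def)

lemma finite_crossings: "finite J \<Longrightarrow> finite K \<Longrightarrow> finite {(j, k). j \<in> J \<and> k \<in> K \<and> k < j}"
  by (rule finite_subset[of _ "J \<times> K"]) auto

lemma crossings_Un_left:
  assumes "finite J" "finite J'" "finite K" "J \<inter> J' = {}"
  shows "crossings (J \<union> J') K = crossings J K + crossings J' K"
proof -
  have "{(j, k). j \<in> J \<union> J' \<and> k \<in> K \<and> k < j} =
      {(j, k). j \<in> J \<and> k \<in> K \<and> k < j} \<union> {(j, k). j \<in> J' \<and> k \<in> K \<and> k < j}"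
    by auto
  then show ?thesis
    unfolding crossings_def
    using assms by (simp only:) (rule card_Un_disjoint; (rule finite_crossings)?; auto)
qed

lemma crossings_Un_right:
  assumes "finite J" "finite K" "finite K'" "K \<inter> K' = {}"
  shows "crossings J (K \<union> K') = crossings J K + crossings J K'"
proof -
  have "{(j, k). j \<in> J \<and> k \<in> K \<union> K' \<and> k < j} =
      {(j, k). j \<in> J \<and> k \<in> K \<and> k < j} \<union> {(j, k). j \<in> J \<and> k \<in> K' \<and> k < j}"
    by auto
  then show ?thesis
    unfolding crossings_def
    using assms by (simp only:) (rule card_Un_disjoint; (rule finite_crossings)?; auto)
qed

lemma crossings_singleton: "crossings {x} K = card {k \<in> K. k < x}"
proof -
  have "{(j, k). j \<in> {x} \<and> k \<in> K \<and> k < j} = Pair x ` {k \<in> K. k < x}" by auto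
  then show ?thesis unfolding crossings_def by (simp only:) (simp add: card_image inj_on_def)
qed

primrec list_inversions :: "nat list \<Rightarrow> nat" where
  "list_inversions [] = 0"
| "list_inversions (x # xs) = crossings {x} (set xs) + list_inversions xs"

lemma list_inversions_append:
  assumes "distinct (xs @ ys)"
  shows "list_inversions (xs @ ys) = list_inversions xs + list_inversions ys + crossings (set xs) (set ys)"
  using assms
proof (induction xs)
  case (Cons x xs)
  have "crossings {x} (set xs \<union> set ys) = crossings {x} (set xs) + crossings {x} (set ys)"
    using Cons.prems by (intro crossings_Un_right) auto
  moreover have "crossings ({x} \<union> set xs) (set ys) = crossings {x} (set ys) + crossings (set xs) (set ys)"
    using Cons.prems by (intro crossings_Un_left) auto
  ultimately show ?case using Cons by simp
qed simp

lemma list_inversions_sorted: "sorted xs \<Longrightarrow> list_inversions xs = 0"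
  by (induction xs) (auto simp: crossings_singleton)

text \<open>
  The recursion peels off the first entry, which suits products of generators; this is the
  link to the count of index pairs in the definition of \<open>det\<^sub>q\<close>.
\<close>

lemma list_inversions_conv_card:
  assumes "distinct xs"
  shows "list_inversions xs = card {(i, j). i < j \<and> j < length xs \<and> xs ! j < xs ! i}"
  using assms
proof (induction xs)
  case (Cons x xs)
  let ?I = "\<lambda>xs. {(i, j). i < j \<and> j < length xs \<and> xs ! j < xs ! i}"
  have fin: "finite (?I ys)" for ys :: "nat list"
    by (rule finite_subset[of _ "{..<length ys} \<times> {..<length ys}"]) auto
  let ?Z = "{j. j < length xs \<and> xs ! j < x}"
  have "?I (x # xs) = (\<lambda>j. (0, Suc j)) ` ?Z \<union> map_prod Suc Suc ` ?I xs" (is "?L = ?R")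
  proof (intro equalityI subsetI)
    fix z assume "z \<in> ?L"
    then obtain i j where "z = (i, j)" "i < j" "j < length (x # xs)" "(x # xs) ! j < (x # xs) ! i"
      by auto
    then show "z \<in> ?R"
      by (cases i; cases j) (auto simp: image_iff)
  qed auto
  then have "card (?I (x # xs)) = card ((\<lambda>j. (0::nat, Suc j)) ` ?Z) + card (map_prod Suc Suc ` ?I xs)"
    by (simp only:) (rule card_Un_disjoint, use fin in auto)
  also have "card ((\<lambda>j. (0::nat, Suc j)) ` ?Z) = card ?Z"
    by (intro card_image) (auto simp: inj_on_def)
  also have "card ?Z = card ((!) xs ` ?Z)"
    using Cons.prems by (intro card_image[symmetric]) (auto simp: inj_on_def nth_eq_iff_index_eq)
  also have "(!) xs ` ?Z = {y \<in> set xs. y < x}"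
    by (auto simp: in_set_conv_nth)
  also have "card (map_prod Suc Suc ` ?I xs) = card (?I xs)"
    by (intro card_image) (auto simp: inj_on_def)
  finally show ?case using Cons by (simp add: crossings_singleton)
qed simp

section \<open>The quantum exterior algebra\<close>

locale quantum_exterior = complex_algebra scale
  for scale :: "complex \<Rightarrow> 'a :: {ring, monoid_mult} \<Rightarrow> 'a" +
  fixes q :: complex
  assumes q_nonzero: "q \<noteq> 0"
begin

text \<open>
  The factor in \<open>\<psi>\<^sub>k \<psi>\<^sub>i = p \<psi>\<^sub>i \<psi>\<^sub>k\<close> for \<open>i < k\<close>.
\<close>

definition p :: complex where "p = - inverse q"

lemma p_nonzero [simp]: "p \<noteq> 0"
  using q_nonzero by (simp add: p_def)

lemma scale_assoc_simps:
  "scale c x * y = scale c (x * y)" "x * scale c y = scale c (x * y)"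
  by (rule scale_mult_left scale_mult_right)+

text \<open>
  An element is the function sending \<open>I\<close> to the coefficient of the increasing monomial \<open>\<psi>\<^sub>I\<close>, and
  \<open>\<psi>\<^sub>J \<psi>\<^sub>K = p ^ crossings J K \<psi>\<^bsub>J \<union> K\<^esub>\<close> for disjoint \<open>J\<close> and \<open>K\<close>. Only finite \<open>I\<close> are meaningful; a product
  vanishes on infinite \<open>I\<close> since it is then a sum over an infinite set.
\<close>

definition wedge :: "(nat set \<Rightarrow> 'a) \<Rightarrow> (nat set \<Rightarrow> 'a) \<Rightarrow> nat set \<Rightarrow> 'a"  (infixl "\<and>\<^sub>q" 70) where
  "f \<and>\<^sub>q g = (\<lambda>I. \<Sum>J\<in>Pow I. scale (p ^ crossings J (I - J)) (f J * g (I - J)))"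

lemma wedge_infinite: "infinite I \<Longrightarrow> (f \<and>\<^sub>q g) I = 0"
  by (simp add: wedge_def)

text \<open>
  Both sides run over the partitions of \<open>I\<close> into three blocks, and \<open>crossings\<close> is a cocycle: on either
  side the exponent counts the crossings between every pair of blocks.
\<close>

lemma wedge_assoc: "(f \<and>\<^sub>q g) \<and>\<^sub>q h = f \<and>\<^sub>q (g \<and>\<^sub>q h)"
proof
  fix I :: "nat set"
  show "((f \<and>\<^sub>q g) \<and>\<^sub>q h) I = (f \<and>\<^sub>q (g \<and>\<^sub>q h)) I"
  proof (cases "finite I")
    case True
    have fin: "finite J" if "J \<subseteq> I" for J
      using that True by (rule finite_subset)
    have "((f \<and>\<^sub>q g) \<and>\<^sub>q h) I = (\<Sum>(J, K)\<in>Sigma (Pow I) Pow.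
        scale (p ^ (crossings J (I - J) + crossings K (J - K))) (f K * g (J - K) * h (I - J)))"
      using True fin
      by (simp add: wedge_def sum_distrib_right scale_sum_right scale_assoc_simps power_add
          sum.Sigma[symmetric])
    also have "\<dots> = (\<Sum>(K, L)\<in>Sigma (Pow I) (\<lambda>K. Pow (I - K)).
        scale (p ^ (crossings K (I - K) + crossings L (I - K - L))) (f K * (g L * h (I - K - L))))"
    proof (rule sum.reindex_bij_witness[of _ "\<lambda>(K, L). (K \<union> L, K)" "\<lambda>(J, K). (K, J - K)"], goal_cases)
      case (5 a)
      obtain J K where a: "a = (J, K)" "K \<subseteq> J" "J \<subseteq> I" using 5 by auto
      \<comment> \<open>The three blocks of the partition are \<open>K\<close>, \<open>L\<close> and \<open>R\<close>.\<close>
      define L R where "L = J - K" and "R = I - J"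
      have J: "J = K \<union> L" and I: "I - K = L \<union> R" "I - K - L = R" "K \<inter> L = {}" "L \<inter> R = {}"
        using a by (auto simp: L_def R_def)
      have f: "finite K" "finite L" "finite R"
        using a fin[of J] True by (auto simp: L_def R_def intro: finite_subset)
      have "crossings J R + crossings K L = crossings K (I - K) + crossings L R"
        unfolding J I by (simp add: crossings_Un_left crossings_Un_right f I)
      then show ?case
        using I by (simp add: a L_def R_def mult.assoc)
    qed auto
    also have "\<dots> = (f \<and>\<^sub>q (g \<and>\<^sub>q h)) I"
      using True fin
      by (simp add: wedge_def sum_distrib_left scale_sum_right scale_assoc_simps power_add
          sum.Sigma[symmetric])
    finally show ?thesis .
  qed (simp add: wedge_infinite)
qed

definition const_form :: "'a \<Rightarrow> nat set \<Rightarrow> 'a" where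
  "const_form r = (\<lambda>I. if I = {} then r else 0)"

definition vec_form :: "(nat \<Rightarrow> 'a) \<Rightarrow> nat set \<Rightarrow> 'a" where
  "vec_form v = (\<lambda>I. if is_singleton I then v (the_elem I) else 0)"

lemma vec_form_singleton [simp]: "vec_form v {i} = v i"
  by (simp add: vec_form_def)

lemma vec_form_infinite: "infinite I \<Longrightarrow> vec_form v I = 0"
  by (auto simp: vec_form_def is_singleton_def)

lemma wedge_const_right:
  assumes "finite I"
  shows "(f \<and>\<^sub>q const_form r) I = f I * r"
proof -
  have "(f \<and>\<^sub>q const_form r) I = (\<Sum>J\<in>{I}. scale (p ^ crossings J (I - J)) (f J * const_form r (I - J)))"
    unfolding wedge_def using assms by (intro sum.mono_neutral_right) (auto simp: const_form_def)
  then show ?thesis by (simp add: const_form_def)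
qed

lemma wedge_const_left:
  assumes "finite I"
  shows "(const_form r \<and>\<^sub>q f) I = r * f I"
proof -
  have "(const_form r \<and>\<^sub>q f) I = (\<Sum>J\<in>{{}}. scale (p ^ crossings J (I - J)) (const_form r J * f (I - J)))"
    unfolding wedge_def using assms by (intro sum.mono_neutral_right) (auto simp: const_form_def)
  then show ?thesis by (simp add: const_form_def)
qed

lemma wedge_vec_left:
  assumes "finite I"
  shows "(vec_form v \<and>\<^sub>q f) I = (\<Sum>i\<in>I. scale (p ^ crossings {i} (I - {i})) (v i * f (I - {i})))"
proof -
  have "(vec_form v \<and>\<^sub>q f) I =
      (\<Sum>J\<in>(\<lambda>i. {i}) ` I. scale (p ^ crossings J (I - J)) (vec_form v J * f (I - J)))"
    unfolding wedge_def using assms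
    by (intro sum.mono_neutral_right) (auto simp: vec_form_def is_singleton_def)
  also have "\<dots> = (\<Sum>i\<in>I. scale (p ^ crossings {i} (I - {i})) (v i * f (I - {i})))"
    by (subst sum.reindex) (auto simp: inj_on_def)
  finally show ?thesis .
qed

lemma wedge_vec_right:
  assumes "finite I"
  shows "(f \<and>\<^sub>q vec_form v) I = (\<Sum>i\<in>I. scale (p ^ crossings (I - {i}) {i}) (f (I - {i}) * v i))"
proof -
  have [simp]: "I - (I - {i}) = {i}" if "i \<in> I" for i using that by auto
  have "(f \<and>\<^sub>q vec_form v) I =
      (\<Sum>J\<in>(\<lambda>i. I - {i}) ` I. scale (p ^ crossings J (I - J)) (f J * vec_form v (I - J)))"
    unfolding wedge_def using assms
  proof (intro sum.mono_neutral_right ballI)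
    fix J assume J: "J \<in> Pow I - (\<lambda>i. I - {i}) ` I"
    have "\<not> is_singleton (I - J)"
    proof
      assume "is_singleton (I - J)"
      then obtain i where "I - J = {i}" by (auto simp: is_singleton_def)
      then have "i \<in> I" "J = I - {i}" using J by auto
      then show False using J by auto
    qed
    then show "scale (p ^ crossings J (I - J)) (f J * vec_form v (I - J)) = 0"
      by (simp add: vec_form_def)
  qed auto
  also have "\<dots> = (\<Sum>i\<in>I. scale (p ^ crossings (I - {i}) {i}) (f (I - {i}) * v i))"
    by (subst sum.reindex) (auto simp: inj_on_def)
  finally show ?thesis .
qed

lemma wedge_zero [simp]: "(\<lambda>I. 0) \<and>\<^sub>q f = (\<lambda>I. 0)" "f \<and>\<^sub>q (\<lambda>I. 0) = (\<lambda>I. 0)"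
  by (simp_all add: wedge_def)

lemma wedge_scale:
  "(\<lambda>I. scale c (f I)) \<and>\<^sub>q g = (\<lambda>I. scale c ((f \<and>\<^sub>q g) I))"
  "f \<and>\<^sub>q (\<lambda>I. scale c (g I)) = (\<lambda>I. scale c ((f \<and>\<^sub>q g) I))"
  by (simp_all add: wedge_def scale_sum_right scale_assoc_simps mult.commute)

lemma wedge_sum_left: "(\<lambda>I. \<Sum>x\<in>X. f x I) \<and>\<^sub>q g = (\<lambda>I. \<Sum>x\<in>X. (f x \<and>\<^sub>q g) I)"
  unfolding wedge_def
  by (subst sum.swap) (simp add: sum_distrib_right scale_sum_right)

lemma wedge_sum_right: "f \<and>\<^sub>q (\<lambda>I. \<Sum>x\<in>X. g x I) = (\<lambda>I. \<Sum>x\<in>X. (f \<and>\<^sub>q g x) I)"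
  unfolding wedge_def
  by (subst sum.swap) (simp add: sum_distrib_left scale_sum_right)

lemma wedge_diff_right: "f \<and>\<^sub>q (\<lambda>I. g I - h I) = (\<lambda>I. (f \<and>\<^sub>q g) I - (f \<and>\<^sub>q h) I)"
  by (simp add: wedge_def right_diff_distrib scale_right_diff_distrib sum_subtractf)

text \<open>
  A product of two elements of degree one lives on two-element sets. Its coefficients are exactly the
  expressions compared by the \<open>q\<close>-Manin relations.
\<close>

lemma wedge_vec_vec:
  assumes "i < k"
  shows "(vec_form v \<and>\<^sub>q vec_form w) {i, k} = v i * w k + scale p (v k * w i)"
proof -
  have d: "{i, k} - {i} = {k}" "{i, k} - {k} = {i}" using assms by auto
  have c: "crossings {i} {k} = 0" "crossings {k} {i} = 1"
    using assms by (simp_all add: crossings_singleton Collect_conv_if)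
  show ?thesis
    using assms by (simp add: wedge_vec_left d c)
qed

lemma wedge_vec_vec_eq_0:
  assumes "\<And>i k. i < k \<Longrightarrow> I \<noteq> {i, k}"
  shows "(vec_form v \<and>\<^sub>q vec_form w) I = 0"
proof (cases "finite I")
  case True
  have "\<not> is_singleton (I - {i})" if "i \<in> I" for i
  proof
    assume "is_singleton (I - {i})"
    then obtain k where "I - {i} = {k}" by (auto simp: is_singleton_def)
    then have "I = {i, k}" "i \<noteq> k" using that by auto
    then show False using assms[of i k] assms[of k i] by (cases "i < k") (auto simp: insert_commute)
  qed
  then have "vec_form w (I - {i}) = 0" if "i \<in> I" for i using that by (simp add: vec_form_def)
  then show ?thesis using True by (simp add: wedge_vec_left)
qed (simp add: wedge_infinite)

lemma wedge_one_left:
  assumes "\<And>I. infinite I \<Longrightarrow> f I = 0"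
  shows "const_form 1 \<and>\<^sub>q f = f"
proof
  show "(const_form 1 \<and>\<^sub>q f) I = f I" for I
    by (cases "finite I") (simp_all add: wedge_const_left wedge_infinite assms)
qed

lemma wedge_one_right:
  assumes "\<And>I. infinite I \<Longrightarrow> f I = 0"
  shows "f \<and>\<^sub>q const_form 1 = f"
proof
  show "(f \<and>\<^sub>q const_form 1) I = f I" for I
    by (cases "finite I") (simp_all add: wedge_const_right wedge_infinite assms)
qed

section \<open>Products of degree-one elements and the determinant\<close>

text \<open>
  The argument \<open>v\<close> is a family of vectors, the \<open>i\<close>-th entry of the \<open>j\<close>-th one being \<open>v j i\<close>: the column
  index comes first because columns are the factors.
\<close>

definition word :: "(nat \<Rightarrow> nat \<Rightarrow> 'a) \<Rightarrow> nat list \<Rightarrow> nat set \<Rightarrow> 'a" where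
  "word v xs = foldr (\<lambda>j f. vec_form (v j) \<and>\<^sub>q f) xs (const_form 1)"

lemma word_simps [simp]:
  "word v [] = const_form 1"
  "word v (x # xs) = vec_form (v x) \<and>\<^sub>q word v xs"
  by (simp_all add: word_def)

lemma word_infinite: "infinite I \<Longrightarrow> word v xs I = 0"
  by (cases xs) (auto simp: const_form_def wedge_infinite)

lemma word_append: "word v (xs @ ys) = word v xs \<and>\<^sub>q word v ys"
  by (induction xs) (simp_all add: wedge_one_left word_infinite wedge_assoc)

lemma word_snoc: "word v (xs @ [j]) = word v xs \<and>\<^sub>q vec_form (v j)"
  by (simp add: word_append wedge_one_right vec_form_infinite)

lemma word_degree:
  assumes "card I \<noteq> length xs"
  shows "word v xs I = 0"
proof (cases "finite I")
  case True
  then show ?thesis using assms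
  proof (induction xs arbitrary: I)
    case (Cons x xs)
    have "word v xs (I - {i}) = 0" if "i \<in> I" for i
    proof (rule Cons.IH)
      have "card I > 0" using that Cons.prems(1) by (auto simp: card_gt_0_iff)
      then show "card (I - {i}) \<noteq> length xs"
        using that Cons.prems by (simp add: card_Diff_singleton)
    qed (use Cons.prems in auto)
    then show ?case using Cons.prems by (simp add: wedge_vec_left)
  qed (auto simp: const_form_def)
qed (simp add: word_infinite)

lemma word_support:
  assumes "\<And>j i. j \<in> set xs \<Longrightarrow> i \<notin> Q \<Longrightarrow> v j i = 0" and "\<not> I \<subseteq> Q"
  shows "word v xs I = 0"
proof (cases "finite I")
  case True
  then show ?thesis using assms
  proof (induction xs arbitrary: I)
    case (Cons x xs)
    have "v x i * word v xs (I - {i}) = 0" if "i \<in> I" for i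
    proof (cases "i \<in> Q")
      case True
      then have "word v xs (I - {i}) = 0"
        using Cons.prems by (intro Cons.IH) auto
      then show ?thesis by simp
    qed (use Cons.prems in simp)
    then show ?case using Cons.prems by (simp add: wedge_vec_left)
  qed (auto simp: const_form_def)
qed (simp add: word_infinite)

text \<open>
  Multiplying out and sorting the generators: each choice of distinct row indices contributes its
  monomial, and sorting the generators costs one factor \<open>p\<close> for every inversion.
\<close>

lemma word_expansion:
  assumes "finite T" "card T = length xs"
  shows "word v xs T = (\<Sum>is\<in>permutations_of_set T.
    scale (p ^ list_inversions is) (prod_list (map2 v xs is)))"
  using assms
proof (induction xs arbitrary: T)
  case Nil
  then show ?case by (simp add: const_form_def)
next
  case (Cons x xs)
  have ne: "T \<noteq> {}" using Cons.prems by auto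
  have IH: "word v xs (T - {i}) = (\<Sum>is\<in>permutations_of_set (T - {i}).
      scale (p ^ list_inversions is) (prod_list (map2 v xs is)))" if "i \<in> T" for i
    using Cons.prems that by (intro Cons.IH) (auto simp: card_Diff_singleton)
  have "(\<Sum>is\<in>permutations_of_set T. scale (p ^ list_inversions is) (prod_list (map2 v (x # xs) is))) =
      (\<Sum>i\<in>T. \<Sum>is\<in>(#) i ` permutations_of_set (T - {i}).
        scale (p ^ list_inversions is) (prod_list (map2 v (x # xs) is)))"
    unfolding permutations_of_set_nonempty[OF ne]
    using Cons.prems by (intro sum.UNION_disjoint) auto
  also have "\<dots> = (\<Sum>i\<in>T. scale (p ^ crossings {i} (T - {i})) (v x i * word v xs (T - {i})))"
  proof (intro sum.cong refl)
    fix i assume i: "i \<in> T"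
    have "(\<Sum>is\<in>(#) i ` permutations_of_set (T - {i}).
        scale (p ^ list_inversions is) (prod_list (map2 v (x # xs) is))) =
      (\<Sum>is\<in>permutations_of_set (T - {i}).
        scale (p ^ crossings {i} (T - {i}) * p ^ list_inversions is) (v x i * prod_list (map2 v xs is)))"
      by (subst sum.reindex)
        (auto simp: inj_on_def power_add permutations_of_set_def intro!: sum.cong)
    then show "(\<Sum>is\<in>(#) i ` permutations_of_set (T - {i}).
        scale (p ^ list_inversions is) (prod_list (map2 v (x # xs) is))) =
        scale (p ^ crossings {i} (T - {i})) (v x i * word v xs (T - {i}))"
      by (simp add: IH[OF i] sum_distrib_left scale_sum_right scale_assoc_simps)
  qed
  finally show ?case using Cons.prems by (simp add: wedge_vec_left)
qed

lemma bij_betw_permutes_permutations_of_set: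
  "bij_betw (\<lambda>\<tau>. map (\<lambda>j. t + \<tau> j) [0..<l]) {\<tau>. \<tau> permutes {0..<l}}
     (permutations_of_set {t..<t + l})"
proof (rule bij_betw_imageI)
  show "inj_on (\<lambda>\<tau>. map (\<lambda>j. t + \<tau> j) [0..<l]) {\<tau>. \<tau> permutes {0..<l}}"
  proof (rule inj_onI, rule ext)
    fix \<sigma> \<tau> j
    assume *: "\<sigma> \<in> {\<tau>. \<tau> permutes {0..<l}}" "\<tau> \<in> {\<tau>. \<tau> permutes {0..<l}}"
      "map (\<lambda>j. t + \<sigma> j) [0..<l] = map (\<lambda>j. t + \<tau> j) [0..<l]"
    show "\<sigma> j = \<tau> j"
      using * by (cases "j < l") (auto simp: permutes_not_in)
  qed
  show "(\<lambda>\<tau>. map (\<lambda>j. t + \<tau> j) [0..<l]) ` {\<tau>. \<tau> permutes {0..<l}} =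
      permutations_of_set {t..<t + l}"
  proof (intro equalityI subsetI)
    fix xs assume "xs \<in> (\<lambda>\<tau>. map (\<lambda>j. t + \<tau> j) [0..<l]) ` {\<tau>. \<tau> permutes {0..<l}}"
    then obtain \<tau> where \<tau>: "\<tau> permutes {0..<l}" and xs: "xs = map (\<lambda>j. t + \<tau> j) [0..<l]"
      by auto
    have "set xs = (+) t ` \<tau> ` {0..<l}" unfolding xs by auto
    also have "\<dots> = {t..<t + l}"
      by (simp add: permutes_image[OF \<tau>] add.commute)
    finally show "xs \<in> permutations_of_set {t..<t + l}"
      using permutes_inj[OF \<tau>] unfolding xs
      by (intro permutations_of_setI) (auto simp: distinct_map inj_on_def)
  next
    fix xs assume "xs \<in> permutations_of_set {t..<t + l}"
    then have xs: "set xs = {t..<t + l}" "distinct xs"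
      by (auto dest: permutations_of_setD)
    then have len: "length xs = l" by (metis card_atLeastLessThan diff_add_inverse distinct_card)
    define \<tau> where "\<tau> = (\<lambda>j. if j < l then xs ! j - t else j)"
    have nth: "xs ! j \<in> {t..<t + l}" if "j < l" for j
      using that len unfolding xs(1)[symmetric] by simp
    have "inj_on \<tau> {0..<l}"
    proof (rule inj_onI)
      fix i j assume ij: "i \<in> {0..<l}" "j \<in> {0..<l}" "\<tau> i = \<tau> j"
      then have "xs ! i = xs ! j" using nth[of i] nth[of j] by (auto simp: \<tau>_def)
      then show "i = j" using ij xs(2) len by (simp add: nth_eq_iff_index_eq)
    qed
    moreover have "\<tau> ` {0..<l} \<subseteq> {0..<l}" using nth by (force simp: \<tau>_def)
    ultimately have "bij_betw \<tau> {0..<l} {0..<l}"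
      by (simp add: bij_betw_def endo_inj_surj)
    then have "\<tau> permutes {0..<l}"
      by (rule bij_imp_permutes) (simp add: \<tau>_def)
    moreover have "xs = map (\<lambda>j. t + \<tau> j) [0..<l]"
      using nth len by (intro nth_equalityI) (auto simp: \<tau>_def)
    ultimately show "xs \<in> (\<lambda>\<tau>. map (\<lambda>j. t + \<tau> j) [0..<l]) ` {\<tau>. \<tau> permutes {0..<l}}"
      by blast
  qed
qed

lemma powi_eq_p_power: "(- q) powi (- int k) = p ^ k"
  by (simp add: p_def power_int_minus power_inverse flip: inverse_minus_eq)

text \<open>
  The offset \<open>t\<close> allows a diagonal block to keep the indices that it has in the big matrix.
\<close>

lemma word_top_eq_q_det:
  "word v [t..<t + l] {t..<t + l} = q_det scale q (mat l l (\<lambda>(i, j). v (t + j) (t + i)))"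
proof -
  let ?h = "\<lambda>\<tau>. map (\<lambda>j. t + \<tau> j) [0..<l]"
  have "word v [t..<t + l] {t..<t + l} = (\<Sum>is\<in>permutations_of_set {t..<t + l}.
      scale (p ^ list_inversions is) (prod_list (map2 v [t..<t + l] is)))"
    by (rule word_expansion) auto
  also have "\<dots> = (\<Sum>\<tau> | \<tau> permutes {0..<l}.
      scale (p ^ list_inversions (?h \<tau>)) (prod_list (map2 v [t..<t + l] (?h \<tau>))))"
    by (rule sum.reindex_bij_betw[symmetric, OF bij_betw_permutes_permutations_of_set])
  also have "\<dots> = q_det scale q (mat l l (\<lambda>(i, j). v (t + j) (t + i)))"
    unfolding q_det_def dim_col_mat powi_eq_p_power
  proof (intro sum.cong refl)
    fix \<tau> assume "\<tau> \<in> {\<tau>. \<tau> permutes {0..<l}}"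
    then have \<tau>: "\<tau> permutes {0..<l}" by simp
    have "distinct (?h \<tau>)"
      using permutes_inj[OF \<tau>] by (auto simp: distinct_map inj_on_def)
    then have "list_inversions (?h \<tau>) = perm_inversions l \<tau>"
      unfolding list_inversions_conv_card[OF \<open>distinct _\<close>] perm_inversions_def
      by (intro arg_cong[of _ _ card]) auto
    moreover have "map2 v [t..<t + l] (?h \<tau>) =
        map (\<lambda>j. mat l l (\<lambda>(i, j). v (t + j) (t + i)) $$ (\<tau> j, j)) [0..<l]"
      using permutes_in_image[OF \<tau>] by (intro nth_equalityI) auto
    ultimately show "scale (p ^ list_inversions (?h \<tau>)) (prod_list (map2 v [t..<t + l] (?h \<tau>))) =
        scale (p ^ perm_inversions l \<tau>)
          (prod_list (map (\<lambda>j. mat l l (\<lambda>(i, j). v (t + j) (t + i)) $$ (\<tau> j, j)) [0..<l]))"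
      by simp
  qed
  finally show ?thesis .
qed

section \<open>The Manin relations as anticommutation relations\<close>

definition q_anticommuting :: "(nat \<Rightarrow> nat \<Rightarrow> 'a) \<Rightarrow> nat set \<Rightarrow> bool" where
  "q_anticommuting v J \<longleftrightarrow>
     (\<forall>j\<in>J. vec_form (v j) \<and>\<^sub>q vec_form (v j) = (\<lambda>I. 0)) \<and>
     (\<forall>j\<in>J. \<forall>l\<in>J. j < l \<longrightarrow>
        vec_form (v l) \<and>\<^sub>q vec_form (v j) =
        (\<lambda>I. scale p ((vec_form (v j) \<and>\<^sub>q vec_form (v l)) I)))"

lemma vec_wedge_square_iff:
  "vec_form v \<and>\<^sub>q vec_form v = (\<lambda>I. 0) \<longleftrightarrow>
     (\<forall>k. \<forall>i<k. v i * v k = scale (inverse q) (v k * v i))"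
proof
  assume *: "vec_form v \<and>\<^sub>q vec_form v = (\<lambda>I. 0)"
  have "v i * v k = scale (inverse q) (v k * v i)" if "i < k" for i k
    using fun_cong[OF *, of "{i, k}"] that by (simp add: wedge_vec_vec p_def)
  then show "\<forall>k. \<forall>i<k. v i * v k = scale (inverse q) (v k * v i)" by blast
next
  assume *: "\<forall>k. \<forall>i<k. v i * v k = scale (inverse q) (v k * v i)"
  show "vec_form v \<and>\<^sub>q vec_form v = (\<lambda>I. 0)"
  proof
    fix I
    show "(vec_form v \<and>\<^sub>q vec_form v) I = 0"
    proof (cases "\<exists>i k. i < k \<and> I = {i, k}")
      case True
      then show ?thesis using * by (auto simp: wedge_vec_vec p_def)
    qed (auto intro!: wedge_vec_vec_eq_0)
  qed
qed

text \<open>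
  Multiplying the anticommutation relation by \<open>q\<close> turns it into the second Manin relation, read with
  \<open>v\<close> and \<open>w\<close> as the columns \<open>j < l\<close>.
\<close>

lemma cross_relation_iff:
  "w i * v k + scale p (w k * v i) = scale p (v i * w k + scale p (v k * w i)) \<longleftrightarrow>
     v i * w k - w k * v i = scale (inverse q) (v k * w i) - scale q (w i * v k)" (is "?L = ?R \<longleftrightarrow> _")
proof -
  have "?L = ?R \<longleftrightarrow> scale q ?L = scale q ?R"
    by (subst scale_cancel_left) (use q_nonzero in simp)
  also have "scale q ?L = scale q (w i * v k) - w k * v i"
    using q_nonzero by (simp add: p_def scale_right_distrib scale_right_diff_distrib)
  also have "scale q ?R = scale (inverse q) (v k * w i) - v i * w k"
    using q_nonzero by (simp add: p_def scale_right_distrib scale_right_diff_distrib)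
  finally show ?thesis by (auto simp: algebra_simps)
qed

lemma vec_wedge_swap_iff:
  "vec_form w \<and>\<^sub>q vec_form v = (\<lambda>I. scale p ((vec_form v \<and>\<^sub>q vec_form w) I)) \<longleftrightarrow>
     (\<forall>k. \<forall>i<k. v i * w k - w k * v i = scale (inverse q) (v k * w i) - scale q (w i * v k))"
proof
  assume *: "vec_form w \<and>\<^sub>q vec_form v = (\<lambda>I. scale p ((vec_form v \<and>\<^sub>q vec_form w) I))"
  have "v i * w k - w k * v i = scale (inverse q) (v k * w i) - scale q (w i * v k)" if "i < k" for i k
    using fun_cong[OF *, of "{i, k}"] that unfolding cross_relation_iff[symmetric]
    by (simp add: wedge_vec_vec)
  then show "\<forall>k. \<forall>i<k. v i * w k - w k * v i = scale (inverse q) (v k * w i) - scale q (w i * v k)"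
    by blast
next
  assume *: "\<forall>k. \<forall>i<k. v i * w k - w k * v i = scale (inverse q) (v k * w i) - scale q (w i * v k)"
  show "vec_form w \<and>\<^sub>q vec_form v = (\<lambda>I. scale p ((vec_form v \<and>\<^sub>q vec_form w) I))"
  proof
    fix I
    show "(vec_form w \<and>\<^sub>q vec_form v) I = scale p ((vec_form v \<and>\<^sub>q vec_form w) I)"
    proof (cases "\<exists>i k. i < k \<and> I = {i, k}")
      case True
      then obtain i k where I: "i < k" "I = {i, k}" by blast
      show ?thesis
        using * I(1) unfolding I(2) wedge_vec_vec[OF I(1)] cross_relation_iff by blast
    next
      case False
      then have "(vec_form w \<and>\<^sub>q vec_form v) I = 0" "(vec_form v \<and>\<^sub>q vec_form w) I = 0"
        by (auto intro!: wedge_vec_vec_eq_0)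
      then show ?thesis by simp
    qed
  qed
qed

text \<open>
  The renumbering puts a diagonal block at the place that it occupies in the big matrix; the column
  index comes first as in \<open>word\<close>, and the other rows are filled with zeros.
\<close>

definition shifted_entry :: "nat \<Rightarrow> 'a mat \<Rightarrow> nat \<Rightarrow> nat \<Rightarrow> 'a" where
  "shifted_entry t K j i = (if t \<le> i \<and> i < t + dim_row K then K $$ (i - t, j - t) else 0)"

text \<open>
  The relations hold in the exterior algebra if and only if they hold at every coefficient \<open>{i, k}\<close>;
  the coefficients that involve a zero row give trivial identities.
\<close>

lemma q_manin_iff_q_anticommuting:
  "q_manin scale q K \<longleftrightarrow> q_anticommuting (shifted_entry t K) {t..<t + dim_col K}"
proof -
  let ?v = "shifted_entry t K" and ?r = "dim_row K" and ?c = "dim_col K"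
  have shift: "(\<forall>j\<in>{t..<t + ?c}. R j) \<longleftrightarrow> (\<forall>j<?c. R (t + j))" for R
  proof
    assume *: "\<forall>j<?c. R (t + j)"
    show "\<forall>j\<in>{t..<t + ?c}. R j"
    proof
      fix j assume "j \<in> {t..<t + ?c}"
      then show "R j" using *[rule_format, of "j - t"] by auto
    qed
  qed auto
  have rows: "(\<forall>k. \<forall>i<k. R (?v j i) (?v j k) (?v l i) (?v l k)) \<longleftrightarrow>
      (\<forall>k<?r. \<forall>i<k. R (K $$ (i, j - t)) (K $$ (k, j - t)) (K $$ (i, l - t)) (K $$ (k, l - t)))"
    (is "?A \<longleftrightarrow> ?B")
    if zero: "\<And>x y. R x 0 y 0" "\<And>x y. R 0 x 0 y" for R :: "'a \<Rightarrow> 'a \<Rightarrow> 'a \<Rightarrow> 'a \<Rightarrow> bool" and j l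
  proof
    assume A: ?A
    show ?B
    proof (intro allI impI)
      fix i k assume "k < ?r" "i < k"
      then show "R (K $$ (i, j - t)) (K $$ (k, j - t)) (K $$ (i, l - t)) (K $$ (k, l - t))"
        using A[rule_format, of "t + i" "t + k"] by (simp add: shifted_entry_def)
    qed
  next
    assume B: ?B
    show ?A
    proof (intro allI impI)
      fix i k :: nat assume ik: "i < k"
      show "R (?v j i) (?v j k) (?v l i) (?v l k)"
        using B[rule_format, of "k - t" "i - t"] ik zero by (simp add: shifted_entry_def)
    qed
  qed
  have sq: "(vec_form (?v j) \<and>\<^sub>q vec_form (?v j) = (\<lambda>I. 0)) \<longleftrightarrow>
      (\<forall>k<?r. \<forall>i<k. K $$ (i, j - t) * K $$ (k, j - t) =
        scale (inverse q) (K $$ (k, j - t) * K $$ (i, j - t)))" for j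
    unfolding vec_wedge_square_iff
    by (rule rows[of "\<lambda>a b c d. a * b = scale (inverse q) (b * a)" j j]) simp_all
  have sw: "(vec_form (?v l) \<and>\<^sub>q vec_form (?v j) =
        (\<lambda>I. scale p ((vec_form (?v j) \<and>\<^sub>q vec_form (?v l)) I))) \<longleftrightarrow>
      (\<forall>k<?r. \<forall>i<k. K $$ (i, j - t) * K $$ (k, l - t) - K $$ (k, l - t) * K $$ (i, j - t) =
        scale (inverse q) (K $$ (k, j - t) * K $$ (i, l - t)) -
        scale q (K $$ (i, l - t) * K $$ (k, j - t)))" for j l
    unfolding vec_wedge_swap_iff
    by (rule rows[of "\<lambda>a b c d. a * d - d * a = scale (inverse q) (b * c) - scale q (c * b)" j l])
      simp_all
  show ?thesis
    unfolding q_anticommuting_def sq sw shift q_manin_def by (simp, blast dest: less_trans)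
qed

section \<open>Reordering anticommuting factors\<close>

text \<open>
  Any two factors commute up to a scalar; which one does not matter for showing that a product with
  a repeated factor vanishes.
\<close>

lemma q_anticommuting_swap:
  assumes "q_anticommuting v J" "x \<in> J" "y \<in> J"
  obtains c where "vec_form (v x) \<and>\<^sub>q vec_form (v y) = (\<lambda>I. scale c ((vec_form (v y) \<and>\<^sub>q vec_form (v x)) I))"
proof (cases x y rule: linorder_cases)
  case less
  then have "vec_form (v y) \<and>\<^sub>q vec_form (v x) = (\<lambda>I. scale p ((vec_form (v x) \<and>\<^sub>q vec_form (v y)) I))"
    using assms by (auto simp: q_anticommuting_def)
  then show ?thesis by (intro that[of "inverse p"]) simp
next
  case equal
  then show ?thesis by (intro that[of 1]) simp
next
  case greater
  then show ?thesis using assms by (intro that[of p]) (auto simp: q_anticommuting_def)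
qed

text \<open>
  Move the first factor to the right until it meets its copy.
\<close>

lemma vec_wedge_word_eq_0:
  assumes v: "q_anticommuting v J" and "set ys \<subseteq> J" "x \<in> set ys"
  shows "vec_form (v x) \<and>\<^sub>q word v ys = (\<lambda>I. 0)"
  using assms(2,3)
proof (induction ys)
  case (Cons y ys)
  show ?case
  proof (cases "x = y")
    case True
    then show ?thesis
      using v Cons.prems by (simp add: wedge_assoc[symmetric] q_anticommuting_def)
  next
    case False
    then obtain c where "vec_form (v x) \<and>\<^sub>q vec_form (v y) =
        (\<lambda>I. scale c ((vec_form (v y) \<and>\<^sub>q vec_form (v x)) I))"
      using q_anticommuting_swap[OF v, of x y] Cons.prems by auto
    moreover have "vec_form (v x) \<and>\<^sub>q word v ys = (\<lambda>I. 0)"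
      using Cons False by auto
    ultimately show ?thesis
      by (simp add: wedge_assoc[symmetric] wedge_scale) (simp add: wedge_assoc)
  qed
qed simp

lemma word_not_distinct:
  assumes v: "q_anticommuting v J" and "set xs \<subseteq> J" "\<not> distinct xs"
  shows "word v xs = (\<lambda>I. 0)"
  using assms(2,3) by (induction xs) (auto simp: vec_wedge_word_eq_0[OF v])

lemma vec_wedge_word_insort:
  assumes v: "q_anticommuting v J" and "set ys \<subseteq> J" "x \<in> J" "x \<notin> set ys" "sorted ys" "distinct ys"
  shows "vec_form (v x) \<and>\<^sub>q word v ys =
    (\<lambda>I. scale (p ^ crossings {x} (set ys)) (word v (insort x ys) I))"
  using assms(2-)
proof (induction ys)
  case (Cons y ys)
  show ?case
  proof (cases "x < y")
    case True
    then have "{k \<in> set (y # ys). k < x} = {}" using Cons.prems by force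
    then show ?thesis using True by (simp only: crossings_singleton) simp
  next
    case False
    then have "y < x" using Cons.prems by auto
    then have "vec_form (v x) \<and>\<^sub>q vec_form (v y) =
        (\<lambda>I. scale p ((vec_form (v y) \<and>\<^sub>q vec_form (v x)) I))"
      using v Cons.prems by (auto simp: q_anticommuting_def)
    then have "vec_form (v x) \<and>\<^sub>q word v (y # ys) =
        (\<lambda>I. scale p ((vec_form (v y) \<and>\<^sub>q (vec_form (v x) \<and>\<^sub>q word v ys)) I))"
      by (simp add: wedge_assoc[symmetric] wedge_scale)
    also have "\<dots> = (\<lambda>I. scale (p ^ Suc (crossings {x} (set ys))) (word v (insort x (y # ys)) I))"
      using Cons \<open>y < x\<close> by (simp add: wedge_scale)
    also have "Suc (crossings {x} (set ys)) = crossings {x} (set (y # ys))"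
    proof -
      have "{k \<in> set (y # ys). k < x} = insert y {k \<in> set ys. k < x}" using \<open>y < x\<close> by auto
      then show ?thesis using Cons.prems by (simp only: crossings_singleton) simp
    qed
    finally show ?thesis .
  qed
qed simp

text \<open>
  The anticommuting elements reorder exactly as the generators do, with the same power of \<open>p\<close>.
\<close>

lemma word_sort:
  assumes v: "q_anticommuting v J" and "set xs \<subseteq> J" "distinct xs"
  shows "word v xs = (\<lambda>I. scale (p ^ list_inversions xs) (word v (sort xs) I))"
  using assms(2-)
proof (induction xs)
  case (Cons x xs)
  then show ?case
    using vec_wedge_word_insort[OF v, of "sort xs" x]
    by (simp add: wedge_scale power_add mult.commute)
qed simp

section \<open>Schur complements\<close>

lemma vec_form_wedge_const: "vec_form v \<and>\<^sub>q const_form r = vec_form (\<lambda>i. v i * r)"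
proof
  show "(vec_form v \<and>\<^sub>q const_form r) I = vec_form (\<lambda>i. v i * r) I" for I
    by (cases "finite I")
      (simp_all add: wedge_const_right wedge_infinite vec_form_infinite, simp add: vec_form_def)
qed

text \<open>
  The first factor has degree \<open>card P\<close> and the second involves only generators from \<open>Q\<close>, which is disjoint
  from \<open>P\<close>. The generators from \<open>P\<close> must therefore all come from the first factor and exhaust it.
\<close>

lemma word_wedge_block:
  assumes P: "finite P" "card P = length xs" and I: "finite I" "I \<subseteq> Q" "P \<inter> Q = {}"
    and \<eta>: "\<And>J. \<not> J \<subseteq> Q \<Longrightarrow> \<eta> J = 0"
  shows "(word v xs \<and>\<^sub>q \<eta>) (P \<union> I) = scale (p ^ crossings P I) (word v xs P * \<eta> I)"
proof -
  have "(word v xs \<and>\<^sub>q \<eta>) (P \<union> I) =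
      (\<Sum>J\<in>{P}. scale (p ^ crossings J (P \<union> I - J)) (word v xs J * \<eta> (P \<union> I - J)))"
    unfolding wedge_def
  proof (intro sum.mono_neutral_right ballI)
    fix J assume J: "J \<in> Pow (P \<union> I) - {P}"
    have "word v xs J * \<eta> (P \<union> I - J) = 0"
    proof (cases "card J = length xs \<and> P \<union> I - J \<subseteq> Q")
      case True
      have "finite J" using J P(1) I(1) by (auto intro: finite_subset)
      moreover have "P \<subseteq> J" using True I(3) by auto
      ultimately have "P = J" using True P(2) by (intro card_subset_eq) auto
      then show ?thesis using J by simp
    next
      case False
      then have "word v xs J = 0 \<or> \<eta> (P \<union> I - J) = 0" using word_degree \<eta> by blast
      then show ?thesis by auto
    qed
    then show "scale (p ^ crossings J (P \<union> I - J)) (word v xs J * \<eta> (P \<union> I - J)) = 0" by simp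
  qed (use P(1) I(1) in auto)
  also have "\<dots> = scale (p ^ crossings P I) (word v xs P * \<eta> I)"
  proof -
    have "P \<union> I - P = I" using I by auto
    then show ?thesis by simp
  qed
  finally show ?thesis .
qed

text \<open>
  Adding right multiples of the columns in \<open>K\<close> to later columns does not change a product that
  starts with all columns in \<open>K\<close>, since a repeated factor makes the product vanish. The multipliers \<open>X l j\<close>
  stand at the right end when the columns are replaced from left to right, so no commutation with
  other coefficients is needed.
\<close>

lemma word_column_operations:
  assumes v: "q_anticommuting v N" and "set K \<subseteq> N" "set js \<subseteq> N"
    and v': "\<And>j. j \<in> set js \<Longrightarrow> vec_form (v' j) =
      (\<lambda>I. vec_form (v j) I - (\<Sum>l\<in>set K. (vec_form (v l) \<and>\<^sub>q const_form (X l j)) I))"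
  shows "word v K \<and>\<^sub>q word v' js = word v (K @ js)"
  using assms(2-)
proof (induction js rule: rev_induct)
  case Nil
  then show ?case by (simp add: wedge_one_right word_infinite)
next
  case (snoc j js)
  have "word v (K @ js) \<and>\<^sub>q vec_form (v l) = (\<lambda>I. 0)" if "l \<in> set K" for l
    using that snoc.prems by (subst word_snoc[symmetric], intro word_not_distinct[OF v]) auto
  then have "word v (K @ js) \<and>\<^sub>q (vec_form (v l) \<and>\<^sub>q const_form (X l j)) = (\<lambda>I. 0)" if "l \<in> set K" for l
    using that by (simp add: wedge_assoc[symmetric])
  then have "word v (K @ js) \<and>\<^sub>q vec_form (v' j) = word v (K @ js @ [j])"
    using snoc.prems by (simp add: wedge_diff_right wedge_sum_right word_snoc[symmetric])
  then show ?case
    using snoc by (simp add: word_snoc wedge_assoc[symmetric])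
qed

lemma mult_left_cancel_left_invertible:
  fixes d :: 'a
  assumes "left_invertible d" "d * x = d * y"
  shows "x = y"
proof -
  obtain e where e: "e * d = 1" using assms(1) by (auto simp: left_invertible_def)
  have "x = e * (d * x)" by (simp add: mult.assoc[symmetric] e)
  also have "\<dots> = y" by (simp add: assms(2) mult.assoc[symmetric] e)
  finally show ?thesis .
qed

text \<open>
  The vectors \<open>v' j\<close> are the columns after block elimination: they arise from \<open>v j\<close> by column operations
  with the columns in \<open>K\<close> and have no entries in the rows \<open>set K\<close>. Relations among the original columns
  are transferred by multiplying with the product over \<open>K\<close>, comparing coefficients, and cancelling the
  determinant of the block.
\<close>

lemma schur_words:
  assumes v: "q_anticommuting v N" and N: "N = set K \<union> Q" "set K \<inter> Q = {}" "finite Q" and K: "distinct K"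
    and v': "\<And>j. j \<in> Q \<Longrightarrow> vec_form (v' j) =
      (\<lambda>I. vec_form (v j) I - (\<Sum>l\<in>set K. (vec_form (v l) \<and>\<^sub>q const_form (X l j)) I))"
    and supp: "\<And>j i. j \<in> Q \<Longrightarrow> i \<notin> Q \<Longrightarrow> v' j i = 0"
  shows word_schur: "set js \<subseteq> Q \<Longrightarrow> I \<subseteq> Q \<Longrightarrow>
      word v (K @ js) (set K \<union> I) = scale (p ^ crossings (set K) I) (word v K (set K) * word v' js I)"
    and q_anticommuting_schur: "left_invertible (word v K (set K)) \<Longrightarrow> q_anticommuting v' Q"
proof -
  let ?d = "word v K (set K)"
  have split: "word v (K @ js) (set K \<union> I) =
      scale (p ^ crossings (set K) I) (?d * word v' js I)" if "set js \<subseteq> Q" "I \<subseteq> Q" for js I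
  proof -
    have "word v (K @ js) = word v K \<and>\<^sub>q word v' js"
      using that N v' by (intro word_column_operations[OF v, symmetric]) auto
    then show ?thesis
      using that N K supp
      by (simp only:) (intro word_wedge_block[of _ _ _ Q] word_support;
          auto simp: distinct_card intro: finite_subset)
  qed
  then show "set js \<subseteq> Q \<Longrightarrow> I \<subseteq> Q \<Longrightarrow>
      word v (K @ js) (set K \<union> I) = scale (p ^ crossings (set K) I) (?d * word v' js I)"
    by blast
  assume d: "left_invertible ?d"
  have two: "vec_form (w a) \<and>\<^sub>q vec_form (w b) = word w [a, b]" for w :: "nat \<Rightarrow> nat \<Rightarrow> 'a" and a b
    by (simp add: wedge_one_right vec_form_infinite)
  \<comment> \<open>A proportionality between words in the original columns passes to the modified columns.\<close>
  have transfer: "word v' js = (\<lambda>I. scale c (word v' js' I))"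
    if *: "word v (K @ js) = (\<lambda>I. scale c (word v (K @ js') I))" and js: "set js \<subseteq> Q" "set js' \<subseteq> Q" for js js' c
  proof
    fix I
    show "word v' js I = scale c (word v' js' I)"
    proof (cases "I \<subseteq> Q")
      case True
      have "scale (p ^ crossings (set K) I) (?d * word v' js I) =
          scale (p ^ crossings (set K) I) (?d * scale c (word v' js' I))"
        using fun_cong[OF *, of "set K \<union> I"] True js
        by (simp add: split scale_assoc_simps mult.commute)
      then have "?d * word v' js I = ?d * scale c (word v' js' I)" by simp
      then show ?thesis by (rule mult_left_cancel_left_invertible[OF d])
    next
      case False
      then have "word v' js I = 0" "word v' js' I = 0"
        using js supp by (auto intro!: word_support[of _ Q])
      then show ?thesis by simp
    qed
  qed
  show "q_anticommuting v' Q"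
    unfolding q_anticommuting_def two
  proof (intro conjI ballI impI)
    fix j assume j: "j \<in> Q"
    have "word v (K @ [j, j]) = (\<lambda>I. 0)"
      using j N by (intro word_not_distinct[OF v]) auto
    then show "word v' [j, j] = (\<lambda>I. 0)"
      using transfer[of "[j, j]" 0 "[j, j]"] j by simp
  next
    fix j l assume jl: "j \<in> Q" "l \<in> Q" "j < l"
    have "vec_form (v l) \<and>\<^sub>q vec_form (v j) = (\<lambda>I. scale p ((vec_form (v j) \<and>\<^sub>q vec_form (v l)) I))"
      using v jl N by (auto simp: q_anticommuting_def)
    then have "word v (K @ [l, j]) = (\<lambda>I. scale p (word v (K @ [j, l]) I))"
      by (simp only: word_append two wedge_scale)
    then show "word v' [l, j] = (\<lambda>I. scale p (word v' [j, l] I))"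
      using jl by (intro transfer) auto
  qed
qed

lemma sort_eq_upt: "distinct xs \<Longrightarrow> set xs = {a..<b} \<Longrightarrow> sort xs = [a..<b]"
  by (rule sorted_distinct_set_unique) auto

lemma shifted_entry_0:
  assumes "M \<in> carrier_mat n n"
  shows "shifted_entry 0 M j i = (if i < n then M $$ (i, j) else 0)"
  using assms by (auto simp: shifted_entry_def)

lemma q_det_eq_word_top:
  assumes "S \<in> carrier_mat l l"
  shows "q_det scale q S = word (shifted_entry t S) [t..<t + l] {t..<t + l}"
proof -
  have "mat l l (\<lambda>(i, j). shifted_entry t S (t + j) (t + i)) = S"
    using assms by (intro eq_matI) (auto simp: shifted_entry_def)
  then show ?thesis by (simp add: word_top_eq_q_det)
qed

text \<open>
  The block with rows and columns \<open>{s..<s + k}\<close> is eliminated; the offsets cover elimination of either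
  diagonal block at once. The equation for \<open>X\<close> says that \<open>D X\<close> is the block in the rows of \<open>D\<close> and
  the remaining columns. The determinant formula has no sign because moving the columns \<open>{t..<t + l}\<close>
  past those of the block costs the same power of \<open>p\<close> as moving the corresponding generators.
\<close>

lemma schur_complement:
  assumes M: "M \<in> carrier_mat n n" "q_manin scale q M"
    and PQ: "{s..<s + k} \<inter> {t..<t + l} = {}" "{s..<s + k} \<union> {t..<t + l} = {0..<n}"
    and D: "D = mat k k (\<lambda>(i, j). M $$ (s + i, s + j))" "left_invertible (q_det scale q D)"
    and X: "\<And>i j. i < k \<Longrightarrow> j < l \<Longrightarrow> (\<Sum>r<k. M $$ (s + i, s + r) * X r j) = M $$ (s + i, t + j)"
    and S: "S = mat l l (\<lambda>(i, j). M $$ (t + i, t + j) - (\<Sum>r<k. M $$ (t + i, s + r) * X r j))"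
  shows "q_manin scale q S" "q_det scale q M = q_det scale q D * q_det scale q S"
proof -
  let ?v = "shifted_entry 0 M" and ?v' = "shifted_entry t S"
  let ?K = "[s..<s + k]" and ?Q = "{t..<t + l}"
  have v: "q_anticommuting ?v {0..<n}"
    using M q_manin_iff_q_anticommuting[of M 0] by simp
  have d: "word ?v ?K (set ?K) = q_det scale q D"
  proof -
    have "i \<in> {0..<n}" if "i \<in> {s..<s + k}" for i using that PQ(2) by blast
    then have "mat k k (\<lambda>(i, j). ?v (s + j) (s + i)) = D"
      unfolding D(1) using M(1) by (intro eq_matI) (auto simp: shifted_entry_0)
    then show ?thesis by (simp add: word_top_eq_q_det)
  qed
  have supp: "?v' j i = 0" if "i \<notin> ?Q" for i j
    using that S by (auto simp: shifted_entry_def)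
  have v': "vec_form (?v' j) =
      (\<lambda>I. vec_form (?v j) I - (\<Sum>c\<in>set ?K. (vec_form (?v c) \<and>\<^sub>q const_form (X (c - s) (j - t))) I))"
    if j: "j \<in> ?Q" for j
  proof -
    have "?v' j i = ?v j i - (\<Sum>c\<in>{s..<s + k}. ?v c i * X (c - s) (j - t))" for i
    proof -
      have sum: "(\<Sum>c\<in>{s..<s + k}. ?v c i * X (c - s) (j - t)) = (\<Sum>r<k. ?v (s + r) i * X r (j - t))"
        by (rule sum.reindex_bij_witness[of _ "\<lambda>r. s + r" "\<lambda>c. c - s"]) auto
      consider "i \<notin> {0..<n}" | "i \<in> {s..<s + k}" | "i \<in> ?Q" using PQ(2) by blast
      then show ?thesis
      proof cases
        case 1
        then have "i \<notin> ?Q" using PQ(2) by blast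
        then show ?thesis using 1 supp by (simp add: shifted_entry_0[OF M(1)])
      next
        case 2
        then have "i \<notin> ?Q" "i \<in> {0..<n}" using PQ by blast+
        moreover have "i - s < k" "j - t < l" using 2 j by auto
        ultimately show ?thesis
          using 2 supp j X[of "i - s" "j - t"] unfolding sum by (auto simp: shifted_entry_0[OF M(1)])
      next
        case 3
        then have "i \<in> {0..<n}" using PQ(2) by blast
        then show ?thesis
          using 3 j unfolding sum unfolding S shifted_entry_0[OF M(1)]
          by (auto simp: shifted_entry_def less_diff_conv2)
      qed
    qed
    then have "vec_form (?v' j) =
        vec_form (\<lambda>i. ?v j i - (\<Sum>c\<in>{s..<s + k}. ?v c i * X (c - s) (j - t)))"
      by (intro arg_cong[of _ _ vec_form] ext)
    then show ?thesis
      unfolding vec_form_wedge_const by (simp only:) (auto simp: vec_form_def)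
  qed
  have left: "left_invertible (word ?v ?K (set ?K))" using d D(2) by simp
  have N: "{0..<n} = set ?K \<union> ?Q" "set ?K \<inter> ?Q = {}" "finite ?Q" "distinct ?K"
    using PQ by auto
  have "q_anticommuting ?v' ?Q"
    by (rule q_anticommuting_schur[OF v N v' _ left]) (auto intro: supp)
  then show "q_manin scale q S"
    using S q_manin_iff_q_anticommuting[of S t] by simp
  have js: "set [t..<t + l] \<subseteq> ?Q" by simp
  have "word ?v (?K @ [t..<t + l]) (set ?K \<union> ?Q) =
      scale (p ^ crossings (set ?K) ?Q) (word ?v ?K (set ?K) * word ?v' [t..<t + l] ?Q)"
    by (rule word_schur[OF v N v' _ js]) (auto intro: supp)
  also have "word ?v' [t..<t + l] ?Q = q_det scale q S"
    using S by (intro q_det_eq_word_top[symmetric]) simp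
  finally have "word ?v (?K @ [t..<t + l]) {0..<n} =
      scale (p ^ crossings (set ?K) ?Q) (q_det scale q D * q_det scale q S)"
    unfolding N(1) d .
  moreover have "distinct (?K @ [t..<t + l])" "set (?K @ [t..<t + l]) = {0..<n}"
    using PQ by auto
  then have "word ?v (?K @ [t..<t + l]) {0..<n} =
      scale (p ^ crossings (set ?K) ?Q) (word ?v [0..<n] {0..<n})"
    using word_sort[OF v, of "?K @ [t..<t + l]"] sort_eq_upt[of "?K @ [t..<t + l]" 0 n]
    by (simp add: list_inversions_append list_inversions_sorted)
  ultimately show "q_det scale q M = q_det scale q D * q_det scale q S"
    using q_det_eq_word_top[OF M(1), of 0] by simp
qed

section \<open>Invertibility of Manin matrices and of their determinants\<close>

text \<open>
  The product of all columns but the \<open>k\<close>-th, multiplied by column \<open>j\<close>, vanishes for \<open>j \<noteq> k\<close> and is a nonzero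
  scalar multiple of the full product for \<open>j = k\<close>. Its top coefficient is a left linear combination of
  the entries of column \<open>j\<close>, which yields a left adjugate.
\<close>

lemma left_invertible_q_det_imp_left_inverse:
  assumes M: "M \<in> carrier_mat n n" "q_manin scale q M" and d: "left_invertible (q_det scale q M)"
  shows "\<exists>N\<in>carrier_mat n n. N * M = 1\<^sub>m n"
proof -
  let ?v = "shifted_entry 0 M" and ?T = "{0..<n}"
  have v: "q_anticommuting ?v ?T"
    using M q_manin_iff_q_anticommuting[of M 0] by simp
  obtain e where e: "e * word ?v [0..<n] ?T = 1"
    using d q_det_eq_word_top[OF M(1), of 0] by (auto simp: left_invertible_def)
  define ks where "ks k = [0..<k] @ [Suc k..<n]" for k
  have ks: "set (ks k) = ?T - {k}" "distinct (ks k @ [k])" if "k < n" for k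
    using that by (auto simp: ks_def)
  \<comment> \<open>The cost of moving column \<open>k\<close> from the last place back to its own.\<close>
  define c where "c k = p ^ list_inversions (ks k @ [k])" for k
  define N where "N = mat n n (\<lambda>(k, i). scale (inverse (c k))
    (e * scale (p ^ crossings (?T - {i}) {i}) (word ?v (ks k) (?T - {i}))))"
  have "N * M = 1\<^sub>m n"
  proof (rule eq_matI)
    fix k j assume "k < dim_row (1\<^sub>m n :: 'a mat)" "j < dim_col (1\<^sub>m n :: 'a mat)"
    then have kj: "k < n" "j < n" by auto
    have entry: "(N * M) $$ (k, j) = (\<Sum>i<n. N $$ (k, i) * M $$ (i, j))"
      using M kj by (intro index_mult_mat_sum[of _ n n _ n]) (auto simp: N_def)
    have expand: "(\<Sum>i<n. N $$ (k, i) * M $$ (i, j)) = scale (inverse (c k)) (e * word ?v (ks k @ [j]) ?T)"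
    proof -
      have "word ?v (ks k @ [j]) ?T = (\<Sum>i\<in>?T. scale (p ^ crossings (?T - {i}) {i})
          (word ?v (ks k) (?T - {i}) * ?v j i))"
        unfolding word_snoc by (rule wedge_vec_right) simp
      moreover have "N $$ (k, i) * M $$ (i, j) = scale (inverse (c k)) (e * scale (p ^ crossings (?T - {i}) {i})
          (word ?v (ks k) (?T - {i}) * ?v j i))" if "i \<in> ?T" for i
      proof -
        have "N $$ (k, i) = scale (inverse (c k))
            (e * scale (p ^ crossings (?T - {i}) {i}) (word ?v (ks k) (?T - {i})))"
          using that kj by (simp add: N_def)
        moreover have "?v j i = M $$ (i, j)"
          using that by (simp add: shifted_entry_0[OF M(1)])
        ultimately show ?thesis by (simp only: scale_assoc_simps mult.assoc)
      qed
      ultimately show ?thesis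
        by (simp only: lessThan_atLeast0 sum_distrib_left scale_sum_right cong: sum.cong)
    qed
    have "scale (inverse (c k)) (e * word ?v (ks k @ [j]) ?T) = (if k = j then 1 else 0)"
    proof (cases "k = j")
      case True
      have "set (ks k @ [k]) = ?T" unfolding set_append ks(1)[OF kj(1)] using kj(1) by auto
      then have "word ?v (ks k @ [k]) ?T = scale (c k) (word ?v [0..<n] ?T)"
        using word_sort[OF v, of "ks k @ [k]"] ks(2)[OF kj(1)] sort_eq_upt[of "ks k @ [k]" 0 n]
        by (simp add: c_def)
      moreover have "c k \<noteq> 0" by (simp add: c_def)
      ultimately show ?thesis using True e by (simp add: scale_assoc_simps)
    next
      case False
      then have "j \<in> set (ks k)" unfolding ks(1)[OF kj(1)] using kj by auto
      then have "word ?v (ks k @ [j]) = (\<lambda>I. 0)"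
        using kj(2) by (intro word_not_distinct[OF v]) (auto simp: ks(1)[OF kj(1)])
      then show ?thesis using False by simp
    qed
    then show "(N * M) $$ (k, j) = 1\<^sub>m n $$ (k, j)"
      unfolding entry expand using kj by simp
  qed (use M in \<open>auto simp: N_def\<close>)
  moreover have "N \<in> carrier_mat n n" by (simp add: N_def)
  ultimately show ?thesis by blast
qed

text \<open>
  The columns of the identity matrix, that is, the generators \<open>\<psi>\<^sub>j\<close> themselves.
\<close>

abbreviation unit_entry :: "nat \<Rightarrow> nat \<Rightarrow> 'a" where
  "unit_entry \<equiv> \<lambda>j i. if i = j then 1 else 0"

lemma word_unit_entry:
  assumes "sorted xs" "distinct xs"
  shows "word unit_entry xs I = (if I = set xs then 1 else 0)"
proof (cases "finite I")
  case True
  then show ?thesis using assms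
  proof (induction xs arbitrary: I)
    case (Cons x xs)
    have "word unit_entry (x # xs) I = (\<Sum>i\<in>I. scale (p ^ crossings {i} (I - {i}))
        (unit_entry x i * word unit_entry xs (I - {i})))"
      using Cons.prems by (simp add: wedge_vec_left)
    also have "\<dots> = (\<Sum>i\<in>I \<inter> {x}. scale (p ^ crossings {i} (I - {i}))
        (unit_entry x i * word unit_entry xs (I - {i})))"
      using Cons.prems by (intro sum.mono_neutral_right) auto
    also have "\<dots> = (if I = set (x # xs) then 1 else 0)"
    proof (cases "x \<in> I")
      case True
      then have "I \<inter> {x} = {x}" by auto
      moreover have "I - {x} = set xs \<longleftrightarrow> I = set (x # xs)" using True Cons.prems by auto
      moreover have "{k \<in> set xs. k < x} = {}" using Cons.prems by force
      then have "crossings {x} (set xs) = 0" unfolding crossings_singleton by (simp only: card.empty)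
      ultimately show ?thesis using Cons by auto
    qed auto
    finally show ?case .
  qed (simp add: const_form_def)
qed (auto simp: word_infinite)

lemma word_unit_entry_central: "r * word unit_entry xs I = word unit_entry xs I * r"
proof (cases "finite I")
  case True
  then show ?thesis
  proof (induction xs arbitrary: I)
    case (Cons x xs)
    have "r * (unit_entry x i * word unit_entry xs (I - {i})) =
        unit_entry x i * word unit_entry xs (I - {i}) * r" for i
      using Cons.IH[of "I - {i}"] Cons.prems by (cases "i = x") (simp_all only: if_True if_False, simp_all)
    then show ?case
      using Cons.prems
      by (simp only: word_simps wedge_vec_left sum_distrib_left sum_distrib_right scale_assoc_simps)
  qed (auto simp: const_form_def)
qed (simp add: word_infinite)

lemma const_wedge_word_unit_entry:
  "const_form r \<and>\<^sub>q word unit_entry xs = word unit_entry xs \<and>\<^sub>q const_form r"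
proof
  show "(const_form r \<and>\<^sub>q word unit_entry xs) I = (word unit_entry xs \<and>\<^sub>q const_form r) I" for I
    using word_unit_entry_central[of r xs I]
    by (cases "finite I") (simp_all add: wedge_const_left wedge_const_right wedge_infinite)
qed

text \<open>
  In the product \<open>\<psi>\<^sub>0 \<dots> \<psi>\<^bsub>n-1\<^esub>\<close> the generators are replaced by \<open>\<Sum>\<^sub>j \<phi>\<^sub>j N\<^sub>j\<^sub>k\<close> one after the other from the left. The
  coefficient \<open>N\<^sub>j\<^sub>k\<close> commutes with the remaining generators and can be moved to the right end. At the end
  only words of length \<open>n\<close> in the \<open>\<phi>\<^sub>j\<close> remain, and each of them is a scalar multiple of \<open>\<phi>\<^sub>0 \<dots> \<phi>\<^bsub>n-1\<^esub>\<close>, the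
  scalar being zero if a factor is repeated.
\<close>

lemma right_inverse_imp_right_invertible_q_det:
  assumes M: "M \<in> carrier_mat n n" "q_manin scale q M" and N: "N \<in> carrier_mat n n" "M * N = 1\<^sub>m n"
  shows "\<exists>r. q_det scale q M * r = 1"
proof -
  let ?v = "shifted_entry 0 M" and ?T = "{0..<n}"
  let ?d = "word ?v [0..<n] ?T"
  have v: "q_anticommuting ?v ?T"
    using M q_manin_iff_q_anticommuting[of M 0] by simp
  have unit: "vec_form (unit_entry k) =
      (\<lambda>I. \<Sum>j\<in>?T. (vec_form (?v j) \<and>\<^sub>q const_form (N $$ (j, k))) I)" if k: "k < n" for k
  proof -
    have "unit_entry k i = (\<Sum>j\<in>?T. ?v j i * N $$ (j, k))" for i
    proof (cases "i < n")
      case True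
      have "unit_entry k i = (M * N) $$ (i, k)" using True k N(2) by auto
      also have "\<dots> = (\<Sum>j<n. M $$ (i, j) * N $$ (j, k))"
        by (rule index_mult_mat_sum[OF M(1) N(1) True k])
      finally show ?thesis using True by (simp add: shifted_entry_0[OF M(1)] lessThan_atLeast0)
    qed (use k in \<open>simp add: shifted_entry_0[OF M(1)]\<close>)
    then have "vec_form (unit_entry k) = vec_form (\<lambda>i. \<Sum>j\<in>?T. ?v j i * N $$ (j, k))"
      by (intro arg_cong[of _ _ vec_form] ext)
    then show ?thesis
      unfolding vec_form_wedge_const by (simp only:) (auto simp: vec_form_def)
  qed
  \<comment> \<open>Here \<open>xs\<close> lists the columns substituted so far and \<open>is\<close> the generators still to be replaced.\<close>
  have "\<exists>r. (word ?v xs \<and>\<^sub>q word unit_entry is) ?T = ?d * r"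
    if "set xs \<subseteq> ?T" "set is \<subseteq> ?T" "length xs + length is = n" for xs "is"
    using that
  proof (induction "is" arbitrary: xs)
    case Nil
    have eq: "word ?v xs \<and>\<^sub>q word unit_entry [] = word ?v xs"
      by (simp add: wedge_one_right word_infinite)
    show ?case
    proof (cases "distinct xs")
      case True
      then have "set xs = ?T" using Nil.prems by (intro card_subset_eq) (auto simp: distinct_card)
      then have "word ?v xs ?T = ?d * scale (p ^ list_inversions xs) 1"
        using word_sort[OF v Nil.prems(1) True] sort_eq_upt[OF True] by (simp add: scale_assoc_simps)
      then show ?thesis unfolding eq by blast
    next
      case False
      then have "word ?v xs ?T = ?d * 0" using word_not_distinct[OF v Nil.prems(1)] by simp
      then show ?thesis unfolding eq by blast
    qed
  next
    case (Cons i "is")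
    let ?W = "word unit_entry is"
    have "word ?v xs \<and>\<^sub>q word unit_entry (i # is) =
        (\<lambda>I. \<Sum>j\<in>?T. (word ?v xs \<and>\<^sub>q ((vec_form (?v j) \<and>\<^sub>q const_form (N $$ (j, i))) \<and>\<^sub>q ?W)) I)"
      using Cons.prems by (simp add: unit wedge_sum_left wedge_sum_right)
    also have "\<dots> = (\<lambda>I. \<Sum>j\<in>?T. ((word ?v (xs @ [j]) \<and>\<^sub>q ?W) \<and>\<^sub>q const_form (N $$ (j, i))) I)"
      by (simp only: wedge_assoc const_wedge_word_unit_entry word_snoc)
    finally have step: "(word ?v xs \<and>\<^sub>q word unit_entry (i # is)) ?T =
        (\<Sum>j\<in>?T. (word ?v (xs @ [j]) \<and>\<^sub>q ?W) ?T * N $$ (j, i))"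
      by (simp only:) (simp add: wedge_const_right)
    have "\<exists>r. (word ?v (xs @ [j]) \<and>\<^sub>q ?W) ?T = ?d * r" if "j \<in> ?T" for j
      using that Cons.prems by (intro Cons.IH) auto
    then obtain r where r: "\<And>j. j \<in> ?T \<Longrightarrow> (word ?v (xs @ [j]) \<and>\<^sub>q ?W) ?T = ?d * r j" by metis
    have "(word ?v xs \<and>\<^sub>q word unit_entry (i # is)) ?T = ?d * (\<Sum>j\<in>?T. r j * N $$ (j, i))"
      unfolding step by (simp add: r sum_distrib_left mult.assoc)
    then show ?case by blast
  qed
  from this[of "[]" "[0..<n]"] obtain r where "(word ?v [] \<and>\<^sub>q word unit_entry [0..<n]) ?T = ?d * r"
    by auto
  then have "word unit_entry [0..<n] ?T = ?d * r"
    by (simp add: wedge_one_left word_infinite)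
  then have "?d * r = 1" by (simp add: word_unit_entry)
  then show ?thesis using q_det_eq_word_top[OF M(1), of 0] by auto
qed

lemma q_manin_invertible:
  assumes M: "M \<in> carrier_mat n n" "q_manin scale q M"
    and "right_invertible_mat M" "left_invertible (q_det scale q M)"
  shows "two_sided_invertible_mat M" "two_sided_invertible (q_det scale q M)"
proof -
  obtain R where R: "R \<in> carrier_mat n n" "M * R = 1\<^sub>m n"
    using assms(3) M(1) by (auto simp: right_invertible_mat_def)
  obtain L where L: "L \<in> carrier_mat n n" "L * M = 1\<^sub>m n"
    using left_invertible_q_det_imp_left_inverse[OF M assms(4)] by auto
  have "L = R" by (rule left_inverse_eq_right_inverse_mat[OF M(1) L(1) R(1) L(2) R(2)])
  then show "two_sided_invertible_mat M"
    using M(1) L R unfolding two_sided_invertible_mat_def is_inverse_mat_def by auto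
  let ?d = "q_det scale q M"
  obtain r where r: "?d * r = 1"
    using right_inverse_imp_right_invertible_q_det[OF M R] by auto
  obtain e where e: "e * ?d = 1"
    using assms(4) by (auto simp: left_invertible_def)
  have "e = e * (?d * r)" by (simp add: r)
  also have "\<dots> = r" by (simp add: e mult.assoc[symmetric])
  finally show "two_sided_invertible ?d"
    using r e unfolding two_sided_invertible_def by auto
qed

lemma q_manin_diagonal_block:
  assumes M: "M \<in> carrier_mat n n" "q_manin scale q M" and "s + k \<le> n"
  shows "q_manin scale q (mat k k (\<lambda>(i, j). M $$ (s + i, s + j)))"
  unfolding q_manin_def
proof (intro conjI allI impI, goal_cases)
  case (1 j b a)
  then show ?case
    using M(2)[unfolded q_manin_def, THEN conjunct1, rule_format, of "s + j" "s + b" "s + a"]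
      assms(1,3) by simp
next
  case (2 b a l j)
  then show ?case
    using M(2)[unfolded q_manin_def, THEN conjunct2, rule_format, of "s + b" "s + a" "s + l" "s + j"]
      assms(1,3) by simp
qed

end

section \<open>The Schur complement theorem\<close>

theorem proposition4p9:
  fixes scale :: "complex \<Rightarrow> 'a :: {ring, monoid_mult} \<Rightarrow> 'a"
    and q :: complex
    and n m :: nat
    and M A B C D :: "'a mat"
  assumes "complex_algebra scale"
    and "q \<noteq> 0"
    and "m \<le> n"
    and "M \<in> carrier_mat n n"
    and "A \<in> carrier_mat m m"
    and "B \<in> carrier_mat m (n - m)"
    and "C \<in> carrier_mat (n - m) m"
    and "D \<in> carrier_mat (n - m) (n - m)"
    and "M = four_block_mat A B C D"
    and "q_manin scale q M"
    and "right_invertible_mat M"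
    and "right_invertible_mat A"
    and "right_invertible_mat D"
    and "left_invertible (q_det scale q M)"
    and "left_invertible (q_det scale q A)"
    and "left_invertible (q_det scale q D)"
  shows "(two_sided_invertible_mat M \<and> two_sided_invertible_mat A \<and> two_sided_invertible_mat D \<and>
          two_sided_invertible (q_det scale q M) \<and>
          two_sided_invertible (q_det scale q A) \<and>
          two_sided_invertible (q_det scale q D)) \<and>
         q_manin scale q (A - B * inverse_mat D * C) \<and>
         q_manin scale q (D - C * inverse_mat A * B) \<and>
         q_det scale q M = q_det scale q D * q_det scale q (A - B * inverse_mat D * C) \<and>
         q_det scale q M = q_det scale q A * q_det scale q (D - C * inverse_mat A * B)"
proof -
  interpret quantum_exterior scale q
    using assms(1,2) by (simp add: quantum_exterior_def quantum_exterior_axioms_def)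
  note car = assms(4-8)
  have A: "A = mat m m (\<lambda>(i, j). M $$ (0 + i, 0 + j))"
    and D: "D = mat (n - m) (n - m) (\<lambda>(i, j). M $$ (m + i, m + j))"
    using car unfolding assms(9) by (auto intro!: eq_matI)
  have manin: "q_manin scale q A" "q_manin scale q D"
    using q_manin_diagonal_block[OF car(1) assms(10), of 0 m]
      q_manin_diagonal_block[OF car(1) assms(10), of m "n - m"] assms(3) A D by auto
  note invM = q_manin_invertible[OF car(1) assms(10,11,14)]
  note invA = q_manin_invertible[OF car(2) manin(1) assms(12,15)]
  note invD = q_manin_invertible[OF car(5) manin(2) assms(13,16)]
  have iA: "inverse_mat A \<in> carrier_mat m m" "A * inverse_mat A = 1\<^sub>m m"
    using is_inverse_inverse_mat[OF car(2) invA(1)] car(2) by (auto simp: is_inverse_mat_def)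
  have iD: "inverse_mat D \<in> carrier_mat (n - m) (n - m)" "D * inverse_mat D = 1\<^sub>m (n - m)"
    using is_inverse_inverse_mat[OF car(5) invD(1)] car(5) by (auto simp: is_inverse_mat_def)
  have XD: "inverse_mat D * C \<in> carrier_mat (n - m) m" "D * (inverse_mat D * C) = C"
    using car iD by (simp_all del: assoc_mult_mat add: assoc_mult_mat[symmetric] one_mat_mult_left)
  have XA: "inverse_mat A * B \<in> carrier_mat m (n - m)" "A * (inverse_mat A * B) = B"
    using car iA by (simp_all del: assoc_mult_mat add: assoc_mult_mat[symmetric] one_mat_mult_left)
  have entry: "\<And>i j. i < m \<Longrightarrow> j < m \<Longrightarrow> M $$ (i, j) = A $$ (i, j)"
    "\<And>i j. i < m \<Longrightarrow> j < n - m \<Longrightarrow> M $$ (i, m + j) = B $$ (i, j)"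
    "\<And>i j. i < n - m \<Longrightarrow> j < m \<Longrightarrow> M $$ (m + i, j) = C $$ (i, j)"
    "\<And>i j. i < n - m \<Longrightarrow> j < n - m \<Longrightarrow> M $$ (m + i, m + j) = D $$ (i, j)"
    using car unfolding assms(9) by auto
  have PQ: "{m..<m + (n - m)} \<inter> {0..<0 + m} = {}" "{m..<m + (n - m)} \<union> {0..<0 + m} = {0..<n}"
    and QP: "{0..<0 + m} \<inter> {m..<m + (n - m)} = {}" "{0..<0 + m} \<union> {m..<m + (n - m)} = {0..<n}"
    using assms(3) by auto
  let ?X = "inverse_mat D * C" and ?Y = "inverse_mat A * B"
  have X: "(\<Sum>r<n - m. M $$ (m + i, m + r) * ?X $$ (r, j)) = M $$ (m + i, 0 + j)"
    if "i < n - m" "j < m" for i j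
    using index_mult_mat_sum[OF car(5) XD(1) that] that by (simp add: XD(2) entry)
  have Y: "(\<Sum>r<m. M $$ (0 + i, 0 + r) * ?Y $$ (r, j)) = M $$ (0 + i, m + j)"
    if "i < m" "j < n - m" for i j
    using index_mult_mat_sum[OF car(2) XA(1) that] that by (simp add: XA(2) entry)
  have SD: "A - B * inverse_mat D * C =
      mat m m (\<lambda>(i, j). M $$ (0 + i, 0 + j) - (\<Sum>r<n - m. M $$ (0 + i, m + r) * ?X $$ (r, j)))"
  proof (rule eq_matI, goal_cases)
    case (1 i j)
    then have ij: "i < m" "j < m" by auto
    have "B * inverse_mat D * C = B * ?X" by (rule assoc_mult_mat[OF car(3) iD(1) car(4)])
    then show ?case
      using ij index_mult_mat_sum[OF car(3) XD(1) ij] car by (simp del: index_mult_mat(1) add: entry)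
  qed (use car in auto)
  have SA: "D - C * inverse_mat A * B =
      mat (n - m) (n - m) (\<lambda>(i, j). M $$ (m + i, m + j) - (\<Sum>r<m. M $$ (m + i, 0 + r) * ?Y $$ (r, j)))"
  proof (rule eq_matI, goal_cases)
    case (1 i j)
    then have ij: "i < n - m" "j < n - m" by auto
    have "C * inverse_mat A * B = C * ?Y" by (rule assoc_mult_mat[OF car(4) iA(1) car(3)])
    then show ?case
      using ij index_mult_mat_sum[OF car(4) XA(1) ij] car by (simp del: index_mult_mat(1) add: entry)
  qed (use car in auto)
  note schurD = schur_complement[OF car(1) assms(10) PQ D assms(16) X SD]
  note schurA = schur_complement[OF car(1) assms(10) QP A assms(15) Y SA]
  show ?thesis using invM invA invD schurD schurA by blast
qed

end
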